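(* Let $n\ge 2$ and let $\mathcal V$ be a variety of Boolean-like algebras of dimension $n$. Then $\mathcal V$ is generated (as a variety) by the class $\{\mathbf A\in\mathcal V: |A|=n\}$. In particular, the variety of pure Boolean-like algebras of dimension $n$ is generated by the algebra $\mathbf n$.
   Context: Fix $n\ge 2$. An algebra $\mathbf A$ of type $\tau$ is an algebra of dimension $n$ ($n$DA) with respect to $\tau$-terms $q$ (of arity $n+1$) and constant terms $\mathsf e_1,\dots,\mathsf e_n$ if $q^{\mathbf A}(\mathsf e_i^{\mathbf A},b_1,\dots,b_n)=b_i$ for all $b_j\in A$, $1\le i\le n$. $\theta(a,b)$ is the smallest congruence containing $(a,b)$. An element $c$ is $n$-central if the map $a\mapsto (a/\theta(c,\mathsf e_1),\dots,a/\theta(c,\mathsf e_n))$ is an isomorphism from $\mathbf A$ onto $\prod_{i=1}^n\mathbf A/\theta(c,\mathsf e_i)$. An $n$BA is an $n$DA all of whose elements are $n$-central. A variety of $n$BAs is a variety $\mathcal V$ of type $\tau$ each member of which is an $n$BA with respect to the same terms $q,\mathsf e_1,\dots,\mathsf e_n$. A pure $n$BA is an $n$BA of type $\nu_n=(q,\mathsf e_1,\dots,\mathsf e_n)$ ($q$ of arity $n+1$, each $\mathsf e_i$ nullary) with respect to these basic operations. The algebra $\mathbf n$ has universe $\{\mathsf e_1,\dots,\mathsf e_n\}$ ($n$ distinct elements), the constants interpreted as themselves, and $q^{\mathbf n}(\mathsf e_i,x_1,\dots,x_n)=x_i$. *)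

theory Defs
  imports Main "HOL-Library.FuncSet"
begin

text \<open>
  A similarity type is a partial map from symbols to arities; its domain is the set of operation
  symbols. Terms are built over countably many variables.
\<close>

type_synonym 'f signature = "'f \<Rightarrow> nat option"

datatype 'f tm = Var nat | Fun 'f "'f tm list"

primrec vars :: "'f tm \<Rightarrow> nat set" where
  "vars (Var x) = {x}"
| "vars (Fun f ts) = \<Union> (set (map vars ts))"

primrec wf_tm :: "'f signature \<Rightarrow> 'f tm \<Rightarrow> bool" where
  "wf_tm \<tau> (Var x) \<longleftrightarrow> True"
| "wf_tm \<tau> (Fun f ts) \<longleftrightarrow> \<tau> f = Some (length ts) \<and> list_all (wf_tm \<tau>) ts"

text \<open>
  Values of \<open>oper\<close> on symbols outside the signature, on lists of the wrong length, or on arguments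
  outside the universe are irrelevant; no notion below depends on them.
\<close>

record ('f, 'a) algebra =
  univ :: "'a set"
  oper :: "'f \<Rightarrow> 'a list \<Rightarrow> 'a"

definition is_algebra :: "'f signature \<Rightarrow> ('f, 'a) algebra \<Rightarrow> bool" where
  "is_algebra \<tau> A \<longleftrightarrow> univ A \<noteq> {} \<and>
     (\<forall>f xs. \<tau> f = Some (length xs) \<and> set xs \<subseteq> univ A \<longrightarrow> oper A f xs \<in> univ A)"

primrec eval :: "('f, 'a) algebra \<Rightarrow> (nat \<Rightarrow> 'a) \<Rightarrow> 'f tm \<Rightarrow> 'a" where
  "eval A \<rho> (Var x) = \<rho> x"
| "eval A \<rho> (Fun f ts) = oper A f (map (eval A \<rho>) ts)"

text \<open>
  The \<open>k\<close>-ary term operation of a term whose variables are among \<open>Var 0, \<dots>, Var (k - 1)\<close>, applied to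
  a list of \<open>k\<close> elements.
\<close>

definition term_op :: "('f, 'a) algebra \<Rightarrow> 'f tm \<Rightarrow> 'a list \<Rightarrow> 'a" where
  "term_op A t xs = eval A (\<lambda>i. xs ! i) t"

subsection \<open>Varieties\<close>

definition satisfies :: "('f, 'a) algebra \<Rightarrow> 'f tm \<times> 'f tm \<Rightarrow> bool" where
  "satisfies A st \<longleftrightarrow> (\<forall>\<rho>. range \<rho> \<subseteq> univ A \<longrightarrow> eval A \<rho> (fst st) = eval A \<rho> (snd st))"

definition models :: "'f signature \<Rightarrow> ('f tm \<times> 'f tm) set \<Rightarrow> ('f, 'a) algebra set" where
  "models \<tau> \<Sigma> = {A. is_algebra \<tau> A \<and> (\<forall>st\<in>\<Sigma>. satisfies A st)}"

text \<open>
  Varieties are equational classes. The type \<open>'a\<close> plays the role of the set-theoretic universe from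
  which universes of algebras are taken. Closure under H, S and P would not do as a definition over
  a fixed \<open>'a\<close>, since direct products of algebras over \<open>'a\<close> need not fit into \<open>'a\<close>.
\<close>

definition variety :: "'f signature \<Rightarrow> ('f, 'a) algebra set \<Rightarrow> bool" where
  "variety \<tau> V \<longleftrightarrow>
     (\<exists>\<Sigma>. (\<forall>(s, t)\<in>\<Sigma>. wf_tm \<tau> s \<and> wf_tm \<tau> t) \<and> V = models \<tau> \<Sigma>)"

definition generated_variety ::
    "'f signature \<Rightarrow> ('f, 'a) algebra set \<Rightarrow> ('f, 'a) algebra set" where
  "generated_variety \<tau> K = \<Inter> {V. variety \<tau> V \<and> K \<subseteq> V}"

subsection \<open>Congruences, quotients, products, isomorphisms\<close>

definition congruence :: "'f signature \<Rightarrow> ('f, 'a) algebra \<Rightarrow> ('a \<times> 'a) set \<Rightarrow> bool" where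
  "congruence \<tau> A r \<longleftrightarrow> equiv (univ A) r \<and>
     (\<forall>f xs ys. \<tau> f = Some (length xs) \<and> list_all2 (\<lambda>x y. (x, y) \<in> r) xs ys
        \<longrightarrow> (oper A f xs, oper A f ys) \<in> r)"

definition princ_cong :: "'f signature \<Rightarrow> ('f, 'a) algebra \<Rightarrow> 'a \<Rightarrow> 'a \<Rightarrow> ('a \<times> 'a) set" where
  "princ_cong \<tau> A a b = \<Inter> {r. congruence \<tau> A r \<and> (a, b) \<in> r}"

definition quotient_alg :: "('f, 'a) algebra \<Rightarrow> ('a \<times> 'a) set \<Rightarrow> ('f, 'a set) algebra" where
  "quotient_alg A r =
     \<lparr> univ = univ A // r,
       oper = (\<lambda>f Xs. r `` {oper A f (map (\<lambda>X. SOME x. x \<in> X) Xs)}) \<rparr>"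

definition product_alg :: "'i set \<Rightarrow> ('i \<Rightarrow> ('f, 'a) algebra) \<Rightarrow> ('f, 'i \<Rightarrow> 'a) algebra" where
  "product_alg I B =
     \<lparr> univ = (\<Pi>\<^sub>E i\<in>I. univ (B i)),
       oper = (\<lambda>f xs. \<lambda>i\<in>I. oper (B i) f (map (\<lambda>x. x i) xs)) \<rparr>"

definition alg_iso ::
    "'f signature \<Rightarrow> ('f, 'a) algebra \<Rightarrow> ('f, 'b) algebra \<Rightarrow> ('a \<Rightarrow> 'b) \<Rightarrow> bool" where
  "alg_iso \<tau> A B h \<longleftrightarrow> bij_betw h (univ A) (univ B) \<and>
     (\<forall>f xs. \<tau> f = Some (length xs) \<and> set xs \<subseteq> univ A
        \<longrightarrow> h (oper A f xs) = oper B f (map h xs))"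

subsection \<open>Boolean-like algebras of dimension \<open>n\<close>\<close>

definition dim_terms :: "'f signature \<Rightarrow> nat \<Rightarrow> 'f tm \<Rightarrow> (nat \<Rightarrow> 'f tm) \<Rightarrow> bool" where
  "dim_terms \<tau> n q e \<longleftrightarrow> wf_tm \<tau> q \<and> vars q \<subseteq> {0..n} \<and>
     (\<forall>i\<in>{1..n}. wf_tm \<tau> (e i) \<and> vars (e i) = {})"

definition is_nDA ::
    "'f signature \<Rightarrow> nat \<Rightarrow> 'f tm \<Rightarrow> (nat \<Rightarrow> 'f tm) \<Rightarrow> ('f, 'a) algebra \<Rightarrow> bool" where
  "is_nDA \<tau> n q e A \<longleftrightarrow> is_algebra \<tau> A \<and> dim_terms \<tau> n q e \<and>
     (\<forall>b. (\<forall>j\<in>{1..n}. b j \<in> univ A) \<longrightarrow>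
        (\<forall>i\<in>{1..n}. term_op A q (term_op A (e i) [] # map b [1..<Suc n]) = b i))"

definition n_central ::
    "'f signature \<Rightarrow> nat \<Rightarrow> (nat \<Rightarrow> 'f tm) \<Rightarrow> ('f, 'a) algebra \<Rightarrow> 'a \<Rightarrow> bool" where
  "n_central \<tau> n e A c \<longleftrightarrow>
     (let \<theta> = (\<lambda>i. princ_cong \<tau> A c (term_op A (e i) []))
      in alg_iso \<tau> A (product_alg {1..n} (\<lambda>i. quotient_alg A (\<theta> i)))
           (\<lambda>a. \<lambda>i\<in>{1..n}. \<theta> i `` {a}))"

definition is_nBA ::
    "'f signature \<Rightarrow> nat \<Rightarrow> 'f tm \<Rightarrow> (nat \<Rightarrow> 'f tm) \<Rightarrow> ('f, 'a) algebra \<Rightarrow> bool" where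
  "is_nBA \<tau> n q e A \<longleftrightarrow> is_nDA \<tau> n q e A \<and> (\<forall>c\<in>univ A. n_central \<tau> n e A c)"

definition variety_of_nBAs ::
    "'f signature \<Rightarrow> nat \<Rightarrow> 'f tm \<Rightarrow> (nat \<Rightarrow> 'f tm) \<Rightarrow> ('f, 'a) algebra set \<Rightarrow> bool" where
  "variety_of_nBAs \<tau> n q e V \<longleftrightarrow> variety \<tau> V \<and> (\<forall>A\<in>V. is_nBA \<tau> n q e A)"

subsection \<open>Pure Boolean-like algebras of dimension \<open>n\<close>\<close>

datatype nu_sym = Qsym | Esym nat

definition nu_sig :: "nat \<Rightarrow> nu_sym signature" where
  "nu_sig n = (\<lambda>s. case s of Qsym \<Rightarrow> Some (Suc n)
                           | Esym i \<Rightarrow> if i \<in> {1..n} then Some 0 else None)"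

definition is_pure_nBA :: "nat \<Rightarrow> (nu_sym, 'a) algebra \<Rightarrow> bool" where
  "is_pure_nBA n A \<longleftrightarrow>
     is_nBA (nu_sig n) n (Fun Qsym (map Var [0..<Suc n])) (\<lambda>i. Fun (Esym i) []) A"

text \<open>
  The algebra \<open>\<^bold>n\<close> on the elements \<open>\<epsilon> 1, \<dots>, \<epsilon> n\<close>, which are meant to be pairwise distinct
  (\<open>inj_on \<epsilon> {1..n}\<close>). For \<open>x = \<epsilon> i\<close>, the operation \<open>Qsym\<close> sends \<open>[x, x\<^sub>1, \<dots>, x\<^sub>n]\<close> to \<open>x\<^sub>i\<close>,
  which is the entry at position \<open>i\<close> of this list since positions count from \<open>0\<close>.
\<close>

definition alg_n :: "nat \<Rightarrow> (nat \<Rightarrow> 'a) \<Rightarrow> (nu_sym, 'a) algebra" where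
  "alg_n n \<epsilon> =
     \<lparr> univ = \<epsilon> ` {1..n},
       oper = (\<lambda>s xs. case s of Esym i \<Rightarrow> \<epsilon> i
                              | Qsym \<Rightarrow> xs ! (the_inv_into {1..n} \<epsilon> (hd xs))) \<rparr>"

end

theory Submission
  imports Defs "HOL-Library.Nat_Bijection"
begin

text \<open>
  If an identity fails in a member \<open>A\<close> of the variety at distinct values \<open>a\<close> and \<open>b\<close>, divide by a
  congruence that is maximal among those not identifying \<open>a\<close> and \<open>b\<close>. In the quotient every proper
  enlargement of the identity relation identifies \<open>a\<close> and \<open>b\<close>, so \<open>n\<close>-centrality of \<open>c\<close> (the
  congruences \<open>\<theta>(c, e\<^sub>i)\<close> meet in the identity) forces some \<open>\<theta>(c, e\<^sub>i)\<close> to be trivial, that is,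
  \<open>c = e\<^sub>i\<close>. The quotient therefore consists of the \<open>n\<close> constants, and the identity fails there.

  For pure algebras, \<open>n\<close>-centrality of all elements is equivalent to finitely many identities saying
  that \<open>q(c, -, \<dots>, -)\<close> is a decomposition operation. So they form a variety, and its members
  consisting of \<open>n\<close> distinct constants are copies of \<open>\<^bold>n\<close>.
\<close>

section \<open>Term evaluation and surjective homomorphisms\<close>

lemma eval_in_univ:
  assumes "is_algebra \<tau> A" and "range \<rho> \<subseteq> univ A" and "wf_tm \<tau> t"
  shows "eval A \<rho> t \<in> univ A"
  using assms(3)
proof (induction t)
  case (Var x)
  then show ?case using assms(2) by auto
next
  case (Fun f ts)
  have "set (map (eval A \<rho>) ts) \<subseteq> univ A"
    using Fun by (auto simp: list_all_iff)
  then show ?case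
    using assms(1) Fun.prems unfolding is_algebra_def by simp
qed

lemma eval_cong:
  assumes "\<And>x. x \<in> vars t \<Longrightarrow> \<rho> x = \<sigma> x"
  shows "eval A \<rho> t = eval A \<sigma> t"
  using assms
proof (induction t)
  case (Fun f ts)
  then have "map (eval A \<rho>) ts = map (eval A \<sigma>) ts"
    by auto
  then show ?case by (simp del: map_eq_conv)
qed simp

lemma term_op_closed: "vars t = {} \<Longrightarrow> term_op A t [] = eval A \<rho> t"
  unfolding term_op_def by (rule eval_cong) simp

lemma term_op_closed_in_univ:
  assumes "is_algebra \<tau> A" and "wf_tm \<tau> t" and "vars t = {}"
  shows "term_op A t [] \<in> univ A"
proof -
  obtain a where "a \<in> univ A"
    using assms(1) unfolding is_algebra_def by auto
  then have "eval A (\<lambda>_. a) t \<in> univ A"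
    by (intro eval_in_univ[OF assms(1) _ assms(2)]) auto
  then show ?thesis
    using term_op_closed[OF assms(3)] by metis
qed

text \<open>Homomorphic images are the only closure property of varieties used below, once for
  quotients and once for images of \<open>alg_n\<close>. The definition does not ask that
  \<open>B\<close> be an algebra, since this follows when \<open>A\<close> is one.\<close>

definition alg_epi ::
    "'f signature \<Rightarrow> ('f, 'a) algebra \<Rightarrow> ('f, 'b) algebra \<Rightarrow> ('a \<Rightarrow> 'b) \<Rightarrow> bool" where
  "alg_epi \<tau> A B h \<longleftrightarrow> h ` univ A = univ B \<and>
     (\<forall>f xs. \<tau> f = Some (length xs) \<and> set xs \<subseteq> univ A
        \<longrightarrow> h (oper A f xs) = oper B f (map h xs))"

lemma alg_epi_eval:
  assumes "is_algebra \<tau> A" and "alg_epi \<tau> A B h" and "range \<rho> \<subseteq> univ A" and "wf_tm \<tau> t"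
  shows "h (eval A \<rho> t) = eval B (h \<circ> \<rho>) t"
  using assms(4)
proof (induction t)
  case (Fun f ts)
  have "set (map (eval A \<rho>) ts) \<subseteq> univ A"
    using Fun.prems eval_in_univ[OF assms(1,3)] by (auto simp: list_all_iff)
  then have "h (eval A \<rho> (Fun f ts)) = oper B f (map h (map (eval A \<rho>) ts))"
    using assms(2) Fun.prems unfolding alg_epi_def by simp
  also have "map h (map (eval A \<rho>) ts) = map (eval B (h \<circ> \<rho>)) ts"
    using Fun by (simp add: list_all_iff comp_def)
  finally show ?case by (simp add: comp_def)
qed simp

lemma alg_epi_term_op_closed:
  assumes "is_algebra \<tau> A" and "alg_epi \<tau> A B h" and "wf_tm \<tau> t" and "vars t = {}"
  shows "h (term_op A t []) = term_op B t []"
proof -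
  obtain a where "a \<in> univ A"
    using assms(1) unfolding is_algebra_def by auto
  then have "h (eval A (\<lambda>_. a) t) = eval B (h \<circ> (\<lambda>_. a)) t"
    using alg_epi_eval[OF assms(1,2) _ assms(3)] by force
  then show ?thesis
    using term_op_closed[OF assms(4)] by metis
qed

lemma alg_epi_set_lift:
  assumes "alg_epi \<tau> A B h" and "set ys \<subseteq> univ B"
  obtains xs where "set xs \<subseteq> univ A" and "map h xs = ys"
proof
  have 1: "\<exists>x. x \<in> univ A \<and> h x = y" if "y \<in> set ys" for y
    using assms that unfolding alg_epi_def by (metis imageE subsetD)
  let ?g = "\<lambda>y. SOME x. x \<in> univ A \<and> h x = y"
  have g: "?g y \<in> univ A \<and> h (?g y) = y" if "y \<in> set ys" for y
    using someI_ex[OF 1[OF that]] .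
  show "set (map ?g ys) \<subseteq> univ A" "map h (map ?g ys) = ys"
    using g by (auto intro: map_idI)
qed

lemma alg_epi_is_algebra:
  assumes "is_algebra \<tau> A" and h: "alg_epi \<tau> A B h"
  shows "is_algebra \<tau> B"
  unfolding is_algebra_def
proof (intro conjI allI impI)
  show "univ B \<noteq> {}"
    using assms unfolding is_algebra_def alg_epi_def by auto
next
  fix f ys
  assume ys: "\<tau> f = Some (length ys) \<and> set ys \<subseteq> univ B"
  then obtain xs where xs: "set xs \<subseteq> univ A" "map h xs = ys"
    using alg_epi_set_lift[OF h] by blast
  have len: "\<tau> f = Some (length xs)"
    using ys xs(2) by auto
  then have "oper B f ys = h (oper A f xs)"
    using h xs unfolding alg_epi_def by metis
  moreover have "oper A f xs \<in> univ A"
    using assms(1) xs(1) len unfolding is_algebra_def by blast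
  ultimately show "oper B f ys \<in> univ B"
    using h unfolding alg_epi_def by blast
qed

lemma alg_epi_satisfies:
  assumes "is_algebra \<tau> A" and h: "alg_epi \<tau> A B h"
    and "wf_tm \<tau> s" and "wf_tm \<tau> t" and "satisfies A (s, t)"
  shows "satisfies B (s, t)"
  unfolding satisfies_def
proof (intro allI impI)
  fix \<sigma> :: "nat \<Rightarrow> _"
  assume \<sigma>: "range \<sigma> \<subseteq> univ B"
  have "\<exists>x. x \<in> univ A \<and> h x = \<sigma> k" for k
    using h \<sigma> unfolding alg_epi_def by (metis imageE range_subsetD)
  then obtain \<rho> where \<rho>: "\<And>k. \<rho> k \<in> univ A \<and> h (\<rho> k) = \<sigma> k"
    by metis
  then have r: "range \<rho> \<subseteq> univ A" and \<sigma>_eq: "\<sigma> = h \<circ> \<rho>"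
    by auto
  show "eval B \<sigma> (fst (s, t)) = eval B \<sigma> (snd (s, t))"
    using alg_epi_eval[OF assms(1) h r] assms(3-5) r
    unfolding \<sigma>_eq satisfies_def by (metis fst_conv snd_conv)
qed

lemma alg_epi_variety:
  assumes "variety \<tau> V" and "A \<in> V" and "alg_epi \<tau> A B h"
  shows "B \<in> V"
proof -
  obtain \<Sigma> where wf: "\<forall>(s, t)\<in>\<Sigma>. wf_tm \<tau> s \<and> wf_tm \<tau> t" and V: "V = models \<tau> \<Sigma>"
    using assms(1) unfolding variety_def by blast
  have A: "is_algebra \<tau> A" "\<forall>st\<in>\<Sigma>. satisfies A st"
    using assms(2) unfolding V models_def by auto
  show ?thesis
    unfolding V models_def
    using alg_epi_is_algebra[OF A(1) assms(3)] alg_epi_satisfies[OF A(1) assms(3)] wf A(2)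
    by fast
qed

section \<open>Congruences\<close>

lemma congruence_Inter:
  assumes "R \<noteq> {}" and "\<And>r. r \<in> R \<Longrightarrow> congruence \<tau> A r"
  shows "congruence \<tau> A (\<Inter>R)"
proof -
  have e: "equiv (univ A) r" if "r \<in> R" for r
    using assms(2)[OF that] unfolding congruence_def by blast
  have "equiv (univ A) (\<Inter>R)"
  proof (rule equivI)
    show "\<Inter>R \<subseteq> univ A \<times> univ A" "refl_on (univ A) (\<Inter>R)"
      using assms(1) e unfolding equiv_def refl_on_def by blast+
    show "sym (\<Inter>R)"
      using e unfolding equiv_def sym_def by blast
    show "trans (\<Inter>R)"
      using e unfolding equiv_def trans_def by (meson InterE InterI)
  qed
  moreover have "(oper A f xs, oper A f ys) \<in> \<Inter>R"
    if "\<tau> f = Some (length xs)" "list_all2 (\<lambda>x y. (x, y) \<in> \<Inter>R) xs ys" for f xs ys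
  proof
    fix r assume r: "r \<in> R"
    then have "list_all2 (\<lambda>x y. (x, y) \<in> r) xs ys"
      using that(2) by (auto elim: list_all2_mono)
    then show "(oper A f xs, oper A f ys) \<in> r"
      using assms(2)[OF r] that(1) unfolding congruence_def by blast
  qed
  ultimately show ?thesis
    unfolding congruence_def by blast
qed

lemma congruence_total:
  assumes "is_algebra \<tau> A"
  shows "congruence \<tau> A (univ A \<times> univ A)"
  unfolding congruence_def
proof (intro conjI allI impI)
  show "equiv (univ A) (univ A \<times> univ A)"
    by (auto intro!: equivI simp: refl_on_def sym_def trans_def)
next
  fix f xs ys
  assume *: "\<tau> f = Some (length xs) \<and> list_all2 (\<lambda>x y. (x, y) \<in> univ A \<times> univ A) xs ys"
  then have "set xs \<subseteq> univ A" "set ys \<subseteq> univ A" "length xs = length ys"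
    by (auto simp: list_all2_conv_all_nth in_set_conv_nth)
  then show "(oper A f xs, oper A f ys) \<in> univ A \<times> univ A"
    using assms * unfolding is_algebra_def by auto
qed

text \<open>The total relation is one of the congruences intersected, so the intersection is not
  over the empty family, which would give all pairs of the type.\<close>

lemma congruence_princ_cong:
  assumes "is_algebra \<tau> A" and "a \<in> univ A" and "b \<in> univ A"
  shows "congruence \<tau> A (princ_cong \<tau> A a b)"
  unfolding princ_cong_def
  using congruence_total[OF assms(1)] assms(2,3) by (intro congruence_Inter) auto

lemma princ_cong_contains: "(a, b) \<in> princ_cong \<tau> A a b"
  unfolding princ_cong_def by blast

text \<open>Lets a congruence of a quotient be compared with congruences of \<open>A\<close>, where
  maximality is known.\<close>

lemma congruence_pullback:
  assumes "is_algebra \<tau> A" and h: "alg_epi \<tau> A B h" and r: "congruence \<tau> B r"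
  shows "congruence \<tau> A {(x, y). x \<in> univ A \<and> y \<in> univ A \<and> (h x, h y) \<in> r}" (is "congruence \<tau> A ?s")
proof -
  have e: "equiv (univ B) r" and hA: "h ` univ A = univ B"
    using r h unfolding congruence_def alg_epi_def by auto
  have "equiv (univ A) ?s"
  proof (rule equivI)
    show "?s \<subseteq> univ A \<times> univ A" by auto
    show "refl_on (univ A) ?s"
      using e hA unfolding equiv_def refl_on_def by auto
    show "sym ?s"
      using e unfolding equiv_def sym_def by auto
    show "trans ?s"
      using e unfolding equiv_def trans_def by blast
  qed
  moreover have "(oper A f xs, oper A f ys) \<in> ?s"
    if f: "\<tau> f = Some (length xs)" and l: "list_all2 (\<lambda>x y. (x, y) \<in> ?s) xs ys" for f xs ys
  proof -
    have xy: "set xs \<subseteq> univ A" "set ys \<subseteq> univ A" and len: "length xs = length ys"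
      using l by (auto simp: list_all2_conv_all_nth in_set_conv_nth)
    have "list_all2 (\<lambda>x y. (x, y) \<in> r) (map h xs) (map h ys)"
      using l by (auto simp: list_all2_conv_all_nth)
    then have "(oper B f (map h xs), oper B f (map h ys)) \<in> r"
      using r f unfolding congruence_def by (metis length_map)
    then have "(h (oper A f xs), h (oper A f ys)) \<in> r"
      using h xy f len unfolding alg_epi_def by metis
    then show ?thesis
      using assms(1) xy f len unfolding is_algebra_def by auto
  qed
  ultimately show ?thesis
    unfolding congruence_def by blast
qed

text \<open>Operations are finitary, so the finitely many related pairs of arguments already lie in
  a single member of the chain.\<close>

lemma congruence_Union_chain:
  assumes "R \<noteq> {}" and cong: "\<And>r. r \<in> R \<Longrightarrow> congruence \<tau> A r"
    and chain: "\<And>r s. r \<in> R \<Longrightarrow> s \<in> R \<Longrightarrow> r \<subseteq> s \<or> s \<subseteq> r"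
  shows "congruence \<tau> A (\<Union>R)"
proof -
  have e: "equiv (univ A) r" if "r \<in> R" for r
    using cong[OF that] unfolding congruence_def by blast
  have common: "\<exists>r\<in>R. list_all2 (\<lambda>x y. (x, y) \<in> r) xs ys"
    if "list_all2 (\<lambda>x y. (x, y) \<in> \<Union>R) xs ys" for xs ys
    using that
  proof (induction rule: list_all2_induct)
    case Nil
    then show ?case using assms(1) by auto
  next
    case (Cons x xs y ys)
    then obtain r s where rs: "r \<in> R" "(x, y) \<in> r" "s \<in> R" "list_all2 (\<lambda>x y. (x, y) \<in> s) xs ys"
      by blast
    show ?case
    proof (cases "r \<subseteq> s")
      case True
      then show ?thesis using rs by auto
    next
      case False
      then have "s \<subseteq> r" using chain rs by blast
      then have "list_all2 (\<lambda>x y. (x, y) \<in> r) xs ys"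
        using rs(4) by (auto elim: list_all2_mono)
      then show ?thesis using rs by auto
    qed
  qed
  have "equiv (univ A) (\<Union>R)"
  proof (rule equivI)
    show "\<Union>R \<subseteq> univ A \<times> univ A"
      using e by (intro Union_least) (simp add: equiv_def)
    show "refl_on (univ A) (\<Union>R)"
    proof (rule refl_onI)
      fix x
      assume "x \<in> univ A"
      moreover obtain r where "r \<in> R"
        using assms(1) by blast
      ultimately show "(x, x) \<in> \<Union>R"
        using e[of r] unfolding equiv_def refl_on_def by blast
    qed
    show "sym (\<Union>R)"
      using e unfolding equiv_def by (auto simp: sym_def)
    show "trans (\<Union>R)"
    proof (rule transI)
      fix x y z
      assume "(x, y) \<in> \<Union>R" "(y, z) \<in> \<Union>R"
      \<comment> \<open>Transitivity involves two pairs only; packing them into lists makes it an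
        instance of \<open>common\<close>.\<close>
      then have "list_all2 (\<lambda>x y. (x, y) \<in> \<Union>R) [x, y] [y, z]" by simp
      from common[OF this] obtain r where "r \<in> R" "(x, y) \<in> r" "(y, z) \<in> r"
        by auto
      then show "(x, z) \<in> \<Union>R"
        using e[of r] unfolding equiv_def trans_def by blast
    qed
  qed
  moreover have "(oper A f xs, oper A f ys) \<in> \<Union>R"
    if "\<tau> f = Some (length xs)" and "list_all2 (\<lambda>x y. (x, y) \<in> \<Union>R) xs ys" for f xs ys
    using common[OF that(2)] that(1) cong unfolding congruence_def by blast
  ultimately show ?thesis
    unfolding congruence_def by blast
qed

lemma congruence_Id_on: "is_algebra \<tau> A \<Longrightarrow> congruence \<tau> A (Id_on (univ A))"
  unfolding congruence_def
proof (intro conjI allI impI)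
  show "equiv (univ A) (Id_on (univ A))"
    by (auto intro!: equivI simp: refl_on_def sym_def trans_def)
next
  fix f xs ys
  assume A: "is_algebra \<tau> A"
    and *: "\<tau> f = Some (length xs) \<and> list_all2 (\<lambda>x y. (x, y) \<in> Id_on (univ A)) xs ys"
  then have "set xs \<subseteq> univ A" "xs = ys"
    by (auto simp: list_all2_conv_all_nth in_set_conv_nth Id_on_iff intro!: nth_equalityI)
  then show "(oper A f xs, oper A f ys) \<in> Id_on (univ A)"
    using A * unfolding is_algebra_def by auto
qed

text \<open>Zorn's lemma on the congruences that keep \<open>a\<close> and \<open>b\<close> apart;
  the identity relation is one of them. For \<open>a\<close> and \<open>b\<close> in the universe,
  the quotient by \<open>r\<close> is subdirectly irreducible.\<close>

lemma maximal_congruence_separating: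
  assumes "is_algebra \<tau> A" and "a \<noteq> b"
  obtains r where "congruence \<tau> A r" and "(a, b) \<notin> r"
    and "\<And>s. congruence \<tau> A s \<Longrightarrow> r \<subseteq> s \<Longrightarrow> (a, b) \<notin> s \<Longrightarrow> s = r"
proof -
  let ?C = "{r. congruence \<tau> A r \<and> (a, b) \<notin> r}"
  have "\<exists>r\<in>?C. \<forall>s\<in>?C. r \<subseteq> s \<longrightarrow> s = r"
  proof (rule subset_Zorn_nonempty)
    show "?C \<noteq> {}"
      using congruence_Id_on[OF assms(1)] assms(2) by auto
  next
    fix R
    assume R: "R \<noteq> {}" "subset.chain ?C R"
    then have C: "R \<subseteq> ?C" and chain: "\<And>r s. r \<in> R \<Longrightarrow> s \<in> R \<Longrightarrow> r \<subseteq> s \<or> s \<subseteq> r"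
      unfolding subset_chain_def by blast+
    have "congruence \<tau> A (\<Union>R)"
      using C by (intro congruence_Union_chain[OF R(1) _ chain]) auto
    then show "\<Union>R \<in> ?C"
      using C by auto
  qed
  then show thesis
    using that by blast
qed

text \<open>
  The quotient is realised on a system of representatives, so that it stays within the type
  \<open>'a\<close> and hence within a variety over \<open>'a\<close>.
\<close>

lemma quotient_on_representatives:
  fixes A :: "('f, 'a) algebra"
  assumes r: "congruence \<tau> A r"
  obtains B :: "('f, 'a) algebra" and h
  where "alg_epi \<tau> A B h"
    and "\<And>x y. x \<in> univ A \<Longrightarrow> y \<in> univ A \<Longrightarrow> h x = h y \<longleftrightarrow> (x, y) \<in> r"
proof
  have e: "equiv (univ A) r"
    using r unfolding congruence_def by blast
  define h where "h x = (SOME y. y \<in> r `` {x})" for x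
  define B where "B = \<lparr>univ = h ` univ A, oper = (\<lambda>f xs. h (oper A f xs))\<rparr>"
  have h: "(x, h x) \<in> r" if "x \<in> univ A" for x
  proof -
    have "x \<in> r `` {x}" using e that by (rule equiv_class_self)
    then show ?thesis
      unfolding h_def by (metis Image_singleton_iff someI)
  qed
  show h_eq: "h x = h y \<longleftrightarrow> (x, y) \<in> r" if "x \<in> univ A" "y \<in> univ A" for x y
  proof
    assume "h x = h y"
    then show "(x, y) \<in> r"
      using h[OF that(1)] h[OF that(2)] e unfolding equiv_def sym_def trans_def by metis
  next
    assume "(x, y) \<in> r"
    then show "h x = h y"
      using equiv_class_eq[OF e] unfolding h_def by metis
  qed
  show "alg_epi \<tau> A B h"
    unfolding alg_epi_def
  proof (intro conjI allI impI)
    show "h ` univ A = univ B" by (simp add: B_def)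
  next
    fix f xs
    assume *: "\<tau> f = Some (length xs) \<and> set xs \<subseteq> univ A"
    then have "list_all2 (\<lambda>x y. (x, y) \<in> r) xs (map h xs)"
      using h by (auto simp: list_all2_conv_all_nth subset_iff)
    then have "(oper A f xs, oper A f (map h xs)) \<in> r"
      using r * unfolding congruence_def by blast
    then show "h (oper A f xs) = oper B f (map h xs)"
      using equiv_class_eq[OF e] unfolding h_def B_def by simp
  qed
qed

section \<open>Varieties of Boolean-like algebras are generated by their members of size \<open>n\<close>\<close>

text \<open>Injectivity of the map in the definition of n-centrality: its kernel is the intersection
  of the theta(c, e_i).\<close>

lemma n_central_separates:
  assumes "is_algebra \<tau> A" and c: "c \<in> univ A"
    and e: "\<And>i. i \<in> {1..n} \<Longrightarrow> term_op A (e i) [] \<in> univ A"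
    and central: "n_central \<tau> n e A c" and xy: "x \<in> univ A" "y \<in> univ A"
    and rel: "\<And>i. i \<in> {1..n} \<Longrightarrow> (x, y) \<in> princ_cong \<tau> A c (term_op A (e i) [])"
  shows "x = y"
proof -
  let ?\<theta> = "\<lambda>i. princ_cong \<tau> A c (term_op A (e i) [])"
  have "?\<theta> i `` {x} = ?\<theta> i `` {y}" if "i \<in> {1..n}" for i
    using congruence_princ_cong[OF assms(1) c e[OF that]] rel[OF that]
    unfolding congruence_def by (blast dest: equiv_class_eq)
  then have "(\<lambda>i\<in>{1..n}. ?\<theta> i `` {x}) = (\<lambda>i\<in>{1..n}. ?\<theta> i `` {y})"
    by (intro restrict_ext)
  moreover have "inj_on (\<lambda>a. \<lambda>i\<in>{1..n}. ?\<theta> i `` {a}) (univ A)"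
    using central unfolding n_central_def alg_iso_def bij_betw_def Let_def by blast
  ultimately show ?thesis
    using xy unfolding inj_on_def by blast
qed

lemma nDA_constants_in_univ:
  assumes "is_nDA \<tau> n q e A" and "i \<in> {1..n}"
  shows "term_op A (e i) [] \<in> univ A"
  using assms term_op_closed_in_univ unfolding is_nDA_def dim_terms_def by metis

text \<open>If e_i = e_j with i and j distinct, feeding x at position i and y elsewhere into q(e_i,
  -) = q(e_j, -) gives x = y.\<close>

lemma nDA_constants_inj:
  assumes A: "is_nDA \<tau> n q e A" and xy: "x \<in> univ A" "y \<in> univ A" "x \<noteq> y"
  shows "inj_on (\<lambda>i. term_op A (e i) []) {1..n}"
proof (rule inj_onI, rule ccontr)
  fix i j
  assume i: "i \<in> {1..n}" and j: "j \<in> {1..n}"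
    and eq: "term_op A (e i) [] = term_op A (e j) []" and "i \<noteq> j"
  define b where "b k = (if k = i then x else y)" for k
  have "\<forall>j\<in>{1..n}. b j \<in> univ A"
    using xy unfolding b_def by simp
  then have "term_op A q (term_op A (e k) [] # map b [1..<Suc n]) = b k" if "k \<in> {1..n}" for k
    using A that unfolding is_nDA_def by blast
  then have "b i = b j"
    using i j eq by metis
  then show False
    using \<open>i \<noteq> j\<close> xy(3) unfolding b_def by simp
qed

text \<open>\<open>B\<close> is the quotient by a maximal congruence separating \<open>a\<close> and
  \<open>b\<close>, realised inside the type \<open>'a\<close> so that it is a member of
  \<open>V\<close>.\<close>

lemma nBA_epi_separating:
  fixes V :: "('f, 'a) algebra set"
  assumes V: "variety_of_nBAs \<tau> n q e V" and AV: "A \<in> V"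
    and ab: "a \<in> univ A" "b \<in> univ A" "a \<noteq> b"
  obtains B :: "('f, 'a) algebra" and h
  where "B \<in> V" and "alg_epi \<tau> A B h" and "h a \<noteq> h b"
    and "bij_betw (\<lambda>i. term_op B (e i) []) {1..n} (univ B)"
proof -
  have nA: "is_nDA \<tau> n q e A"
    using V AV unfolding variety_of_nBAs_def is_nBA_def by blast
  have A: "is_algebra \<tau> A" and dim: "dim_terms \<tau> n q e"
    using nA unfolding is_nDA_def by auto
  obtain r where r: "congruence \<tau> A r" "(a, b) \<notin> r"
    and max: "\<And>s. congruence \<tau> A s \<Longrightarrow> r \<subseteq> s \<Longrightarrow> (a, b) \<notin> s \<Longrightarrow> s = r"
    using maximal_congruence_separating[OF A ab(3)] by blast
  obtain B :: "('f, 'a) algebra" and h where h: "alg_epi \<tau> A B h"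
    and ker: "\<And>x y. x \<in> univ A \<Longrightarrow> y \<in> univ A \<Longrightarrow> h x = h y \<longleftrightarrow> (x, y) \<in> r"
    using quotient_on_representatives[OF r(1)] by blast
  have BV: "B \<in> V"
    using alg_epi_variety[OF _ AV h] V unfolding variety_of_nBAs_def by blast
  then have nB: "is_nDA \<tau> n q e B" and central: "\<And>c. c \<in> univ B \<Longrightarrow> n_central \<tau> n e B c"
    using V unfolding variety_of_nBAs_def is_nBA_def by auto
  then have B: "is_algebra \<tau> B"
    unfolding is_nDA_def by blast
  let ?e = "\<lambda>i. term_op B (e i) []"
  have hA: "h ` univ A = univ B"
    using h unfolding alg_epi_def by blast
  have hab: "h a \<noteq> h b" "h a \<in> univ B" "h b \<in> univ B"
    using ker[OF ab(1,2)] r(2) imageI[OF ab(1), of h] imageI[OF ab(2), of h] unfolding hA by simp_all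
  have "c \<in> ?e ` {1..n}" if c: "c \<in> univ B" for c
  proof (rule ccontr)
    assume neq: "c \<notin> ?e ` {1..n}"
    obtain c' where c': "c' \<in> univ A" "h c' = c"
      using c hA by (metis imageE)
    \<comment> \<open>If some theta(c, e_i) kept h a and h b apart, its pullback \<open>?s\<close>
      would contain \<open>r\<close> and equal it by maximality. Then theta(c, e_i) would be trivial
      and c = e_i, against the choice of c.\<close>
    have "(h a, h b) \<in> princ_cong \<tau> B c (?e i)" if i: "i \<in> {1..n}" for i
    proof (rule ccontr)
      let ?\<theta> = "princ_cong \<tau> B c (?e i)"
      let ?s = "{(x, y). x \<in> univ A \<and> y \<in> univ A \<and> (h x, h y) \<in> ?\<theta>}"
      assume "(h a, h b) \<notin> ?\<theta>"
      have \<theta>: "congruence \<tau> B ?\<theta>"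
        using congruence_princ_cong[OF B c nDA_constants_in_univ[OF nB i]] .
      have "r \<subseteq> ?s"
      proof (rule subrelI)
        fix x y
        assume xy: "(x, y) \<in> r"
        then have u: "x \<in> univ A" "y \<in> univ A"
          using r(1) unfolding congruence_def equiv_def refl_on_def by blast+
        moreover have "h x = h y"
          using ker[OF u] xy by blast
        moreover have "(h x, h x) \<in> ?\<theta>"
          using \<theta> u hA unfolding congruence_def equiv_def refl_on_def by blast
        ultimately show "(x, y) \<in> ?s"
          by simp
      qed
      then have "?s = r"
        using max[OF congruence_pullback[OF A h \<theta>]] \<open>(h a, h b) \<notin> ?\<theta>\<close> by blast
      moreover have "h (term_op A (e i) []) = ?e i"
        using alg_epi_term_op_closed[OF A h] dim i unfolding dim_terms_def by blast
      then have "(c', term_op A (e i) []) \<in> ?s"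
        using c' nDA_constants_in_univ[OF nA i] princ_cong_contains by force
      ultimately have "c = ?e i"
        using ker[OF c'(1) nDA_constants_in_univ[OF nA i]] c'(2)
          \<open>h (term_op A (e i) []) = ?e i\<close> by metis
      then show False
        using neq i by blast
    qed
    \<comment> \<open>All theta(c, e_i) relate h a and h b, so n-centrality of c makes them
      equal.\<close>
    then have "h a = h b"
      using n_central_separates[OF B c _ central[OF c] hab(2,3)] nDA_constants_in_univ[OF nB]
      by blast
    then show False
      using hab(1) by blast
  qed
  then have "?e ` {1..n} = univ B"
    using nDA_constants_in_univ[OF nB] by blast
  then have "bij_betw ?e {1..n} (univ B)"
    using nDA_constants_inj[OF nB hab(2,3,1)] unfolding bij_betw_def by blast
  then show thesis
    using that BV h hab(1) by blast
qed

text \<open>If \<open>A\<close> violates an identity of \<open>W\<close>, so does an image of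
  \<open>A\<close> that separates the two values and consists of the n distinct constants. The
  premise \<open>sub\<close> speaks of the constants instead of the cardinality, so that it serves
  both the class of members of size n and the single algebra \<open>alg_n\<close>.\<close>

lemma nBA_variety_subset:
  fixes V W :: "('f, 'a) algebra set"
  assumes V: "variety_of_nBAs \<tau> n q e V" and W: "variety \<tau> W"
    and sub: "\<And>B. B \<in> V \<Longrightarrow> bij_betw (\<lambda>i. term_op B (e i) []) {1..n} (univ B) \<Longrightarrow> B \<in> W"
  shows "V \<subseteq> W"
proof
  fix A
  assume AV: "A \<in> V"
  then have A: "is_algebra \<tau> A"
    using V unfolding variety_of_nBAs_def is_nBA_def is_nDA_def by blast
  obtain \<Sigma> where wf: "\<forall>(s, t)\<in>\<Sigma>. wf_tm \<tau> s \<and> wf_tm \<tau> t" and W_eq: "W = models \<tau> \<Sigma>"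
    using W unfolding variety_def by blast
  have "satisfies A (s, t)" if st: "(s, t) \<in> \<Sigma>" for s t
    unfolding satisfies_def
  proof (intro allI impI, rule ccontr)
    fix \<rho> :: "nat \<Rightarrow> 'a"
    assume \<rho>: "range \<rho> \<subseteq> univ A"
      and neq: "eval A \<rho> (fst (s, t)) \<noteq> eval A \<rho> (snd (s, t))"
    have wf_st: "wf_tm \<tau> s" "wf_tm \<tau> t"
      using wf st by auto
    obtain B :: "('f, 'a) algebra" and h where B: "B \<in> V" "alg_epi \<tau> A B h"
      and ne: "h (eval A \<rho> s) \<noteq> h (eval A \<rho> t)"
      and bij: "bij_betw (\<lambda>i. term_op B (e i) []) {1..n} (univ B)"
      using nBA_epi_separating[OF V AV, of "eval A \<rho> s" "eval A \<rho> t"] neq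
        eval_in_univ[OF A \<rho>] wf_st by auto
    have "satisfies B (s, t)"
      using sub[OF B(1) bij] st unfolding W_eq models_def by blast
    moreover have "range (h \<circ> \<rho>) \<subseteq> univ B"
      using \<rho> B(2) unfolding alg_epi_def by auto
    ultimately have "eval B (h \<circ> \<rho>) s = eval B (h \<circ> \<rho>) t"
      unfolding satisfies_def by (metis fst_conv snd_conv)
    then show False
      using ne alg_epi_eval[OF A B(2) \<rho>] wf_st by simp
  qed
  then show "A \<in> W"
    unfolding W_eq models_def using A by auto
qed

lemma nBA_variety_generated:
  assumes V: "variety_of_nBAs \<tau> n q e V"
  shows "V = generated_variety \<tau> {A \<in> V. card (univ A) = n}"
proof
  show "V \<subseteq> generated_variety \<tau> {A \<in> V. card (univ A) = n}"
    unfolding generated_variety_def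
  proof (rule Inter_greatest)
    fix W
    assume W: "W \<in> {W. variety \<tau> W \<and> {A \<in> V. card (univ A) = n} \<subseteq> W}"
    show "V \<subseteq> W"
    proof (rule nBA_variety_subset[OF V])
      show "variety \<tau> W" using W by blast
    next
      fix B
      assume B: "B \<in> V" and "bij_betw (\<lambda>i. term_op B (e i) []) {1..n} (univ B)"
      then have "card (univ B) = n"
        using bij_betw_same_card by fastforce
      then show "B \<in> W"
        using B W by blast
    qed
  qed
next
  show "generated_variety \<tau> {A \<in> V. card (univ A) = n} \<subseteq> V"
    using V unfolding generated_variety_def variety_of_nBAs_def by blast
qed

section \<open>Pure Boolean-like algebras form a variety\<close>

text \<open>The arguments form a function on all naturals, so that families can be nested and
  updated pointwise; only the values at 1, ..., n count.\<close>

definition qop :: "nat \<Rightarrow> (nu_sym, 'a) algebra \<Rightarrow> 'a \<Rightarrow> (nat \<Rightarrow> 'a) \<Rightarrow> 'a" where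
  "qop n A c M = oper A Qsym (c # map M [1..<Suc n])"

definition ecst :: "(nu_sym, 'a) algebra \<Rightarrow> nat \<Rightarrow> 'a" where
  "ecst A i = oper A (Esym i) []"

lemma term_op_Esym: "term_op A (Fun (Esym i) []) [] = ecst A i"
  by (simp add: term_op_def ecst_def)

lemma qop_cong: "(\<And>i. i \<in> {1..n} \<Longrightarrow> M i = N i) \<Longrightarrow> qop n A c M = qop n A c N"
  unfolding qop_def by (metis (mono_tags, lifting) atLeastLessThanSuc_atLeastAtMost atLeastLessThan_upt map_eq_conv)

lemma ecst_in_univ: "is_algebra (nu_sig n) A \<Longrightarrow> i \<in> {1..n} \<Longrightarrow> ecst A i \<in> univ A"
  unfolding is_algebra_def ecst_def by (auto simp: nu_sig_def)

lemma oper_Qsym_in_univ: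
  "is_algebra (nu_sig n) A \<Longrightarrow> length xs = Suc n \<Longrightarrow> set xs \<subseteq> univ A \<Longrightarrow> oper A Qsym xs \<in> univ A"
  unfolding is_algebra_def by (auto simp: nu_sig_def)

lemma qop_in_univ:
  assumes "is_algebra (nu_sig n) A" and "c \<in> univ A" and "\<And>i. i \<in> {1..n} \<Longrightarrow> M i \<in> univ A"
  shows "qop n A c M \<in> univ A"
  unfolding qop_def using assms by (intro oper_Qsym_in_univ[OF assms(1)]) auto

lemma is_pure_nBA_iff:
  "is_pure_nBA n A \<longleftrightarrow> is_algebra (nu_sig n) A \<and>
     (\<forall>b. (\<forall>j\<in>{1..n}. b j \<in> univ A) \<longrightarrow> (\<forall>i\<in>{1..n}. qop n A (ecst A i) b = b i)) \<and>
     (\<forall>c\<in>univ A. n_central (nu_sig n) n (\<lambda>i. Fun (Esym i) []) A c)"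
proof -
  have "term_op A (Fun Qsym (map Var [0..<Suc n])) (c # map b [1..<Suc n]) = qop n A c b" for c b
  proof -
    let ?xs = "c # map b [1..<Suc n]"
    have "map (\<lambda>i. ?xs ! i) [0..<Suc n] = ?xs"
      using map_nth[of ?xs] by (simp del: upt_Suc)
    then show ?thesis
      unfolding term_op_def qop_def eval.simps map_map comp_def by metis
  qed
  moreover have "dim_terms (nu_sig n) n (Fun Qsym (map Var [0..<Suc n])) (\<lambda>i. Fun (Esym i) [])"
    by (auto simp: dim_terms_def nu_sig_def list_all_iff simp del: upt_Suc)
  ultimately show ?thesis
    unfolding is_pure_nBA_def is_nBA_def is_nDA_def term_op_Esym by (simp del: upt_Suc)
qed

text \<open>
  Commutation with the constants is not listed, since it is an instance of idempotence.
\<close>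

definition nBA_laws :: "nat \<Rightarrow> (nu_sym, 'a) algebra \<Rightarrow> bool" where
  "nBA_laws n A \<longleftrightarrow>
     (\<forall>(M :: nat \<Rightarrow> 'a) i. range M \<subseteq> univ A \<and> i \<in> {1..n} \<longrightarrow> qop n A (ecst A i) M = M i) \<and>
     (\<forall>c\<in>univ A.
        (\<forall>a\<in>univ A. qop n A c (\<lambda>_. a) = a) \<and>
        (\<forall>P. (\<forall>i j. P i j \<in> univ A) \<longrightarrow>
           qop n A c (\<lambda>i. qop n A c (P i)) = qop n A c (\<lambda>i. P i i)) \<and>
        (\<forall>P. (\<forall>i j. P i j \<in> univ A) \<longrightarrow>
           qop n A c (\<lambda>i. oper A Qsym (map (P i) [0..<Suc n])) =
           oper A Qsym (map (\<lambda>j. qop n A c (\<lambda>i. P i j)) [0..<Suc n])) \<and>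
        qop n A c (ecst A) = c)"

lemma nBA_lawsD:
  assumes "nBA_laws n A"
  shows "range M \<subseteq> univ A \<Longrightarrow> i \<in> {1..n} \<Longrightarrow> qop n A (ecst A i) M = M i"
    and "c \<in> univ A \<Longrightarrow> a \<in> univ A \<Longrightarrow> qop n A c (\<lambda>_. a) = a"
    and "c \<in> univ A \<Longrightarrow> (\<And>i j. P i j \<in> univ A) \<Longrightarrow>
      qop n A c (\<lambda>i. qop n A c (P i)) = qop n A c (\<lambda>i. P i i)"
    and "c \<in> univ A \<Longrightarrow> (\<And>i j. P i j \<in> univ A) \<Longrightarrow>
      qop n A c (\<lambda>i. oper A Qsym (map (P i) [0..<Suc n])) =
      oper A Qsym (map (\<lambda>j. qop n A c (\<lambda>i. P i j)) [0..<Suc n])"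
    and "c \<in> univ A \<Longrightarrow> qop n A c (ecst A) = c"
  using assms unfolding nBA_laws_def by blast+

section \<open>The laws as a finite set of identities\<close>

definition qtm :: "nat \<Rightarrow> nu_sym tm \<Rightarrow> (nat \<Rightarrow> nu_sym tm) \<Rightarrow> nu_sym tm" where
  "qtm n t T = Fun Qsym (t # map T [1..<Suc n])"

text \<open>Doubly indexed variables for a matrix of arguments P i j; the shift by
  \<open>Suc\<close> reserves \<open>Var 0\<close> for the element c.\<close>

definition mvar :: "nat \<Rightarrow> nat \<Rightarrow> nu_sym tm" where
  "mvar i j = Var (Suc (prod_encode (i, j)))"

text \<open>\<open>Var 0\<close> plays the role of c in the last four identities; in the first
  family \<open>Var i\<close> is the i-th argument. \<open>Var 1\<close> is also
  \<open>mvar 0 0\<close>, but no identity uses it in both roles.\<close>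

definition nBA_identities :: "nat \<Rightarrow> (nu_sym tm \<times> nu_sym tm) set" where
  "nBA_identities n =
     (\<lambda>i. (qtm n (Fun (Esym i) []) Var, Var i)) ` {1..n} \<union>
     {(qtm n (Var 0) (\<lambda>_. Var 1), Var 1),
      (qtm n (Var 0) (\<lambda>i. qtm n (Var 0) (mvar i)), qtm n (Var 0) (\<lambda>i. mvar i i)),
      (qtm n (Var 0) (\<lambda>i. Fun Qsym (map (mvar i) [0..<Suc n])),
       Fun Qsym (map (\<lambda>j. qtm n (Var 0) (\<lambda>i. mvar i j)) [0..<Suc n])),
      (qtm n (Var 0) (\<lambda>i. Fun (Esym i) []), Var 0)}"

lemma eval_qtm: "eval A \<rho> (qtm n t T) = qop n A (eval A \<rho> t) (\<lambda>i. eval A \<rho> (T i))"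
  by (simp add: qtm_def qop_def comp_def del: upt_Suc)

lemma nu_sig_Qsym: "nu_sig n Qsym = Some (Suc n)"
  by (simp add: nu_sig_def)

lemma wf_Esym: "i \<in> {1..n} \<Longrightarrow> wf_tm (nu_sig n) (Fun (Esym i) [])"
  by (simp add: nu_sig_def)

lemma wf_qtm:
  "wf_tm (nu_sig n) t \<Longrightarrow> (\<And>i. i \<in> {1..n} \<Longrightarrow> wf_tm (nu_sig n) (T i)) \<Longrightarrow> wf_tm (nu_sig n) (qtm n t T)"
  by (auto simp: qtm_def nu_sig_Qsym list_all_iff simp del: upt_Suc)

lemma wf_nBA_identities:
  "\<forall>(s, t)\<in>nBA_identities n. wf_tm (nu_sig n) s \<and> wf_tm (nu_sig n) t"
  unfolding nBA_identities_def
  by (auto intro!: wf_qtm wf_Esym simp: mvar_def nu_sig_Qsym list_all_iff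
      simp del: upt_Suc wf_tm.simps(2) simp: wf_tm.simps(2)[of _ Qsym])

lemma satisfies_nBA_identities_iff:
  fixes A :: "(nu_sym, 'a) algebra"
  shows "(\<forall>st\<in>nBA_identities n. satisfies A st) \<longleftrightarrow> nBA_laws n A" (is "?L \<longleftrightarrow> ?R")
proof
  assume ?L
  then have id: "eval A \<rho> s = eval A \<rho> t" if "(s, t) \<in> nBA_identities n" "range \<rho> \<subseteq> univ A" for s t \<rho>
    using that unfolding satisfies_def by fastforce
  have E: "eval A \<rho> (Fun (Esym i) []) = ecst A i" for \<rho> i
    by (simp add: ecst_def)
  \<comment> \<open>Inverse of the coding in \<open>mvar\<close>: \<open>Var 0\<close> receives c
    and \<open>mvar i j\<close> receives P i j.\<close>
  define asg :: "'a \<Rightarrow> (nat \<Rightarrow> nat \<Rightarrow> 'a) \<Rightarrow> nat \<Rightarrow> 'a"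
    where "asg c P k = (case k of 0 \<Rightarrow> c | Suc m \<Rightarrow> case_prod P (prod_decode m))" for c P k
  have asg: "eval A (asg c P) (Var 0) = c" "eval A (asg c P) (mvar i j) = P i j" for c P i j
    by (simp_all add: asg_def mvar_def)
  have asg_range: "range (asg c P) \<subseteq> univ A" if "c \<in> univ A" "\<And>i j. P i j \<in> univ A" for c P
    using that by (auto simp: asg_def split: nat.split prod.split)
  show ?R
    unfolding nBA_laws_def
  proof (intro conjI allI impI ballI)
    fix M :: "nat \<Rightarrow> 'a" and i
    assume M: "range M \<subseteq> univ A \<and> i \<in> {1..n}"
    have "eval A M (qtm n (Fun (Esym i) []) Var) = eval A M (Var i)"
      using M by (intro id) (auto simp: nBA_identities_def)
    then show "qop n A (ecst A i) M = M i"
      unfolding eval_qtm E by simp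
  next
    fix c a
    assume ca: "c \<in> univ A" "a \<in> univ A"
    \<comment> \<open>\<open>Var 1\<close> decodes to an entry of the matrix, and a constant matrix
      makes every entry a.\<close>
    have "eval A (asg c (\<lambda>_ _. a)) (qtm n (Var 0) (\<lambda>_. Var 1)) = eval A (asg c (\<lambda>_ _. a)) (Var 1)"
      using ca by (intro id asg_range) (auto simp: nBA_identities_def)
    then show "qop n A c (\<lambda>_. a) = a"
      unfolding eval_qtm asg by (simp add: asg_def split: prod.split)
  next
    fix c and P :: "nat \<Rightarrow> nat \<Rightarrow> 'a"
    assume cP: "c \<in> univ A" "\<forall>i j. P i j \<in> univ A"
    have "eval A (asg c P) (qtm n (Var 0) (\<lambda>i. qtm n (Var 0) (mvar i))) =
        eval A (asg c P) (qtm n (Var 0) (\<lambda>i. mvar i i))"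
      using cP by (intro id asg_range) (auto simp: nBA_identities_def)
    then show "qop n A c (\<lambda>i. qop n A c (P i)) = qop n A c (\<lambda>i. P i i)"
      unfolding eval_qtm asg .
  next
    fix c and P :: "nat \<Rightarrow> nat \<Rightarrow> 'a"
    assume cP: "c \<in> univ A" "\<forall>i j. P i j \<in> univ A"
    have "eval A (asg c P) (qtm n (Var 0) (\<lambda>i. Fun Qsym (map (mvar i) [0..<Suc n]))) =
        eval A (asg c P) (Fun Qsym (map (\<lambda>j. qtm n (Var 0) (\<lambda>i. mvar i j)) [0..<Suc n]))"
      using cP by (intro id asg_range) (auto simp: nBA_identities_def)
    then show "qop n A c (\<lambda>i. oper A Qsym (map (P i) [0..<Suc n])) =
        oper A Qsym (map (\<lambda>j. qop n A c (\<lambda>i. P i j)) [0..<Suc n])"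
      unfolding eval_qtm eval.simps(2) map_map comp_def asg .
  next
    fix c
    assume c: "c \<in> univ A"
    have "eval A (\<lambda>_. c) (qtm n (Var 0) (\<lambda>i. Fun (Esym i) [])) = eval A (\<lambda>_. c) (Var 0)"
      using c by (intro id) (auto simp: nBA_identities_def)
    then show "qop n A c (ecst A) = c"
      unfolding eval_qtm E by simp
  qed
next
  assume ?R
  note laws = nBA_lawsD[OF this]
  show ?L
  proof
    fix st
    assume st: "st \<in> nBA_identities n"
    show "satisfies A st"
      unfolding satisfies_def
    proof (intro allI impI)
      fix \<rho> :: "nat \<Rightarrow> 'a"
      assume \<rho>: "range \<rho> \<subseteq> univ A"
      then have \<rho>': "\<rho> k \<in> univ A" for k
        by auto
      \<comment> \<open>Here c is \<open>\<rho> 0\<close>, and P i j is the value of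
        \<open>\<rho>\<close> at the index of \<open>mvar i j\<close>.\<close>
      show "eval A \<rho> (fst st) = eval A \<rho> (snd st)"
        using st laws(1)[OF \<rho>] laws(2-5)[OF \<rho>'[of 0]] \<rho>'
        unfolding nBA_identities_def
        by (auto simp: eval_qtm mvar_def comp_def ecst_def[symmetric] simp del: upt_Suc)
    qed
  qed
qed

section \<open>From n-centrality to the laws\<close>

text \<open>Replacing c by e_i in the first argument stays within theta(c, e_i) and turns q into the
  i-th projection. The selection law enters as the hypothesis \<open>eq\<close>, for this M only,
  since the lemma serves both directions of the equivalence.\<close>

lemma qop_princ_cong_coordinate:
  assumes A: "is_algebra (nu_sig n) A" and c: "c \<in> univ A" and i: "i \<in> {1..n}"
    and M: "range M \<subseteq> univ A" and eq: "qop n A (ecst A i) M = M i"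
  shows "(qop n A c M, M i) \<in> princ_cong (nu_sig n) A c (ecst A i)" (is "_ \<in> ?\<theta>")
proof -
  have cong: "congruence (nu_sig n) A ?\<theta>"
    using congruence_princ_cong[OF A c ecst_in_univ[OF A i]] .
  then have "(M j, M j) \<in> ?\<theta>" for j
    using M unfolding congruence_def equiv_def refl_on_def by blast
  then have "list_all2 (\<lambda>x y. (x, y) \<in> ?\<theta>) (c # map M [1..<Suc n]) (ecst A i # map M [1..<Suc n])"
    using princ_cong_contains[of c "ecst A i"]
    by (simp add: list_all2_map1 list_all2_map2 list.rel_refl del: upt_Suc)
  moreover have "nu_sig n Qsym = Some (length (c # map M [1..<Suc n]))"
    by (simp add: nu_sig_def)
  ultimately have "(qop n A c M, qop n A (ecst A i) M) \<in> ?\<theta>"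
    unfolding qop_def using cong unfolding congruence_def by blast
  then show ?thesis
    unfolding eq .
qed

text \<open>By \<open>sep\<close> each law about c need only be checked modulo every theta(c, e_i).
  There q(c, -) is the i-th projection by \<open>proj\<close>, and the law becomes evident.\<close>

lemma pure_nBA_laws:
  fixes A :: "(nu_sym, 'a) algebra"
  assumes pure: "is_pure_nBA n A"
  shows "nBA_laws n A"
proof -
  let ?\<theta> = "\<lambda>c i. princ_cong (nu_sig n) A c (ecst A i)"
  have A: "is_algebra (nu_sig n) A"
    and nDA: "\<And>M i. range M \<subseteq> univ A \<Longrightarrow> i \<in> {1..n} \<Longrightarrow> qop n A (ecst A i) M = M i"
    and central: "\<And>c. c \<in> univ A \<Longrightarrow> n_central (nu_sig n) n (\<lambda>i. Fun (Esym i) []) A c"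
    using pure unfolding is_pure_nBA_iff by (auto simp: subset_iff)
  have cong: "congruence (nu_sig n) A (?\<theta> c i)" if "c \<in> univ A" "i \<in> {1..n}" for c i
    using congruence_princ_cong[OF A that(1) ecst_in_univ[OF A that(2)]] .
  have sym: "(y, x) \<in> ?\<theta> c i" if "(x, y) \<in> ?\<theta> c i" "c \<in> univ A" "i \<in> {1..n}" for x y c i
    using cong[OF that(2,3)] that(1) unfolding congruence_def equiv_def by (meson symD)
  have trans: "(x, z) \<in> ?\<theta> c i"
    if "(x, y) \<in> ?\<theta> c i" "(y, z) \<in> ?\<theta> c i" "c \<in> univ A" "i \<in> {1..n}" for x y z c i
    using cong[OF that(3,4)] that(1,2) unfolding congruence_def equiv_def by (meson transD)
  have oper: "(oper A Qsym xs, oper A Qsym ys) \<in> ?\<theta> c i"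
    if "list_all2 (\<lambda>x y. (x, y) \<in> ?\<theta> c i) xs ys" "length xs = Suc n" "c \<in> univ A" "i \<in> {1..n}"
    for xs ys c i
    using cong[OF that(3,4)] that(1,2) unfolding congruence_def by (simp add: nu_sig_def)
  have sep: "x = y"
    if "c \<in> univ A" "x \<in> univ A" "y \<in> univ A" "\<And>i. i \<in> {1..n} \<Longrightarrow> (x, y) \<in> ?\<theta> c i" for c x y
    using n_central_separates[OF A that(1) _ central[OF that(1)] that(2,3)]
      that(4) ecst_in_univ[OF A] unfolding term_op_Esym by blast
  have proj: "(qop n A c M, M i) \<in> ?\<theta> c i"
    if c: "c \<in> univ A" and M: "range M \<subseteq> univ A" and i: "i \<in> {1..n}" for c M i
    using qop_princ_cong_coordinate[OF A c i M nDA[OF M i]] .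
  have qop: "qop n A c M \<in> univ A" if "c \<in> univ A" "range M \<subseteq> univ A" for c M
    using qop_in_univ[OF A that(1)] that(2) by blast
  show ?thesis
    unfolding nBA_laws_def
  proof (intro conjI allI impI ballI)
    fix M :: "nat \<Rightarrow> 'a" and i
    assume "range M \<subseteq> univ A \<and> i \<in> {1..n}"
    then show "qop n A (ecst A i) M = M i"
      using nDA by blast
  next
    fix c a
    assume ca: "c \<in> univ A" "a \<in> univ A"
    show "qop n A c (\<lambda>_. a) = a"
    proof (rule sep[OF ca(1) _ ca(2)])
      show "qop n A c (\<lambda>_. a) \<in> univ A"
        using ca by (intro qop) auto
      show "(qop n A c (\<lambda>_. a), a) \<in> ?\<theta> c i" if "i \<in> {1..n}" for i
        using proj[OF ca(1) _ that, of "\<lambda>_. a"] ca(2) by simp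
    qed
  next
    fix c and P :: "nat \<Rightarrow> nat \<Rightarrow> 'a"
    assume c: "c \<in> univ A" and P: "\<forall>i j. P i j \<in> univ A"
    have r: "range (P i) \<subseteq> univ A" "range (\<lambda>i. P i i) \<subseteq> univ A"
      "range (\<lambda>i. qop n A c (P i)) \<subseteq> univ A" for i
      using P qop[OF c] by (auto simp: image_subset_iff)
    show "qop n A c (\<lambda>i. qop n A c (P i)) = qop n A c (\<lambda>i. P i i)"
    proof (rule sep[OF c qop[OF c r(3)] qop[OF c r(2)]])
      fix i
      assume i: "i \<in> {1..n}"
      show "(qop n A c (\<lambda>i. qop n A c (P i)), qop n A c (\<lambda>i. P i i)) \<in> ?\<theta> c i"
        using proj[OF c r(3) i] proj[OF c r(1) i, of i] proj[OF c r(2) i] sym trans c i by meson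
    qed
  next
    fix c and P :: "nat \<Rightarrow> nat \<Rightarrow> 'a"
    assume c: "c \<in> univ A" and P: "\<forall>i j. P i j \<in> univ A"
    let ?x = "qop n A c (\<lambda>i. oper A Qsym (map (P i) [0..<Suc n]))"
    let ?y = "oper A Qsym (map (\<lambda>j. qop n A c (\<lambda>i. P i j)) [0..<Suc n])"
    have r: "range (\<lambda>i. oper A Qsym (map (P i) [0..<Suc n])) \<subseteq> univ A"
      using P by (auto intro!: oper_Qsym_in_univ[OF A] simp del: upt_Suc)
    have r': "range (\<lambda>i. P i j) \<subseteq> univ A" for j
      using P by auto
    show "?x = ?y"
    proof (rule sep[OF c qop[OF c r]])
      show "?y \<in> univ A"
        using qop[OF c r'] by (intro oper_Qsym_in_univ[OF A]) auto
    next
      fix i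
      assume i: "i \<in> {1..n}"
      \<comment> \<open>Modulo theta(c, e_i) the argument q(c, P 1 j, ..., P n j) of
        \<open>?y\<close> collapses to P i j.\<close>
      have "(?y, oper A Qsym (map (P i) [0..<Suc n])) \<in> ?\<theta> c i"
        using proj[OF c r' i] c i
        by (intro oper) (auto simp: list_all2_conv_all_nth simp del: upt_Suc)
      then show "(?x, ?y) \<in> ?\<theta> c i"
        using proj[OF c r i] sym trans c i by meson
    qed
  next
    fix c
    assume c: "c \<in> univ A"
    \<comment> \<open>\<open>ecst A\<close> need not stay in the universe outside {1..n}, while
      \<open>proj\<close> asks for a total family in it; c serves as default value.\<close>
    have eq: "qop n A c (ecst A) = qop n A c (\<lambda>i. if i \<in> {1..n} then ecst A i else c)" (is "_ = qop n A c ?M")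
      by (rule qop_cong) simp
    have M: "range ?M \<subseteq> univ A"
      using c ecst_in_univ[OF A] by auto
    have "qop n A c ?M = c"
    proof (rule sep[OF c qop[OF c M] c])
      fix i
      assume i: "i \<in> {1..n}"
      then have "(qop n A c ?M, ecst A i) \<in> ?\<theta> c i"
        using proj[OF c M i] by simp
      then show "(qop n A c ?M, c) \<in> ?\<theta> c i"
        using sym[OF princ_cong_contains c i] trans c i by meson
    qed
    then show "qop n A c (ecst A) = c"
      using eq by simp
  qed
qed

section \<open>From the laws to n-centrality\<close>

text \<open>The quotient operation picks representatives with \<open>SOME\<close>; compatibility of
  \<open>r\<close> makes the choice irrelevant.\<close>

lemma quotient_alg_oper:
  assumes r: "congruence \<tau> A r" and f: "\<tau> f = Some (length xs)" and xs: "set xs \<subseteq> univ A"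
  shows "oper (quotient_alg A r) f (map (\<lambda>x. r `` {x}) xs) = r `` {oper A f xs}"
proof -
  let ?g = "\<lambda>x. SOME y. y \<in> r `` {x}"
  have e: "equiv (univ A) r"
    using r unfolding congruence_def by blast
  have "(x, ?g x) \<in> r" if "x \<in> univ A" for x
    using someI[of "\<lambda>y. y \<in> r `` {x}", OF equiv_class_self[OF e that]] by blast
  then have "list_all2 (\<lambda>x y. (x, y) \<in> r) xs (map ?g xs)"
    using xs by (auto simp: list_all2_conv_all_nth subset_iff)
  then have "(oper A f xs, oper A f (map ?g xs)) \<in> r"
    using r f unfolding congruence_def by blast
  then show ?thesis
    using equiv_class_eq[OF e] by (simp add: quotient_alg_def comp_def)
qed

text \<open>The map into the product of quotients is always a homomorphism. What remains is that the
  theta(c, e_i) meet in the identity, and a Chinese remainder condition: one element a congruent to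
  M i modulo theta(c, e_i) for all i at once.\<close>

lemma n_centralI:
  fixes A :: "('f, 'a) algebra"
  assumes "is_algebra \<tau> A" and c: "c \<in> univ A"
    and e: "\<And>i. i \<in> {1..n} \<Longrightarrow> term_op A (e i) [] \<in> univ A"
    and inj: "\<And>x y. x \<in> univ A \<Longrightarrow> y \<in> univ A \<Longrightarrow>
      (\<And>i. i \<in> {1..n} \<Longrightarrow> (x, y) \<in> princ_cong \<tau> A c (term_op A (e i) [])) \<Longrightarrow> x = y"
    and surj: "\<And>M. range M \<subseteq> univ A \<Longrightarrow>
      \<exists>a\<in>univ A. \<forall>i\<in>{1..n}. (a, M i) \<in> princ_cong \<tau> A c (term_op A (e i) [])"
  shows "n_central \<tau> n e A c"
proof -
  define \<theta> where "\<theta> i = princ_cong \<tau> A c (term_op A (e i) [])" for i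
  define h where "h a = (\<lambda>i\<in>{1..n}. \<theta> i `` {a})" for a
  have cong: "congruence \<tau> A (\<theta> i)" if "i \<in> {1..n}" for i
    unfolding \<theta>_def using congruence_princ_cong[OF assms(1) c e[OF that]] .
  then have eq: "equiv (univ A) (\<theta> i)" if "i \<in> {1..n}" for i
    using that unfolding congruence_def by blast
  let ?B = "product_alg {1..n} (\<lambda>i. quotient_alg A (\<theta> i))"
  have univ_B: "univ ?B = (\<Pi>\<^sub>E i\<in>{1..n}. univ A // \<theta> i)"
    by (simp add: product_alg_def quotient_alg_def)
  have "inj_on h (univ A)"
  proof (rule inj_onI)
    fix x y
    assume xy: "x \<in> univ A" "y \<in> univ A" and hxy: "h x = h y"
    have "(x, y) \<in> \<theta> i" if "i \<in> {1..n}" for i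
    proof -
      have "\<theta> i `` {x} = \<theta> i `` {y}"
        using fun_cong[OF hxy, of i] that by (simp add: h_def)
      then show ?thesis
        using eq_equiv_class[OF _ eq[OF that] xy(2)] by simp
    qed
    then show "x = y"
      using inj[OF xy] unfolding \<theta>_def by blast
  qed
  moreover have "h ` univ A \<subseteq> univ ?B"
    unfolding univ_B h_def by (auto intro: quotientI)
  moreover have "univ ?B \<subseteq> h ` univ A"
  proof
    fix F
    assume F: "F \<in> univ ?B"
    obtain z where z: "z \<in> univ A"
      using c by blast
    \<comment> \<open>Representatives of the components of F; outside {1..n} any element does, to
      obtain a family on all naturals.\<close>
    have "\<exists>x. x \<in> univ A \<and> (i \<in> {1..n} \<longrightarrow> F i = \<theta> i `` {x})" for i
    proof (cases "i \<in> {1..n}")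
      case True
      then have "F i \<in> univ A // \<theta> i"
        using F unfolding univ_B by blast
      then show ?thesis
        by (auto elim: quotientE)
    qed (use z in auto)
    then obtain M where M: "\<And>i. M i \<in> univ A" "\<And>i. i \<in> {1..n} \<Longrightarrow> F i = \<theta> i `` {M i}"
      by metis
    then obtain a where a: "a \<in> univ A" "\<forall>i\<in>{1..n}. (a, M i) \<in> \<theta> i"
      using surj[of M] unfolding \<theta>_def by blast
    have "F = h a"
    proof
      fix i
      show "F i = h a i"
      proof (cases "i \<in> {1..n}")
        case True
        then show ?thesis
          using M(2)[OF True] equiv_class_eq[OF eq[OF True] bspec[OF a(2) True]]
          unfolding h_def by simp
      next
        case False
        then show ?thesis
          using PiE_arb[OF F[unfolded univ_B] False] unfolding h_def by auto
      qed
    qed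
    then show "F \<in> h ` univ A"
      using a(1) by blast
  qed
  moreover have "h (oper A f xs) = oper ?B f (map h xs)"
    if f: "\<tau> f = Some (length xs)" and xs: "set xs \<subseteq> univ A" for f xs
  proof -
    have "map (\<lambda>x. x i) (map h xs) = map (\<lambda>x. \<theta> i `` {x}) xs" if "i \<in> {1..n}" for i
      using that unfolding h_def by simp
    then have "oper ?B f (map h xs) =
        (\<lambda>i\<in>{1..n}. oper (quotient_alg A (\<theta> i)) f (map (\<lambda>x. \<theta> i `` {x}) xs))"
      unfolding product_alg_def by (auto intro!: restrict_ext simp del: map_map)
    also have "\<dots> = (\<lambda>i\<in>{1..n}. \<theta> i `` {oper A f xs})"
      by (intro restrict_ext quotient_alg_oper[OF cong f xs])
    finally show ?thesis
      unfolding h_def by simp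
  qed
  ultimately have "alg_iso \<tau> A ?B h"
    unfolding alg_iso_def bij_betw_def by blast
  then show ?thesis
    unfolding n_central_def Let_def h_def \<theta>_def .
qed

text \<open>Idempotence rewrites each other entry M k as q(c, M k, ..., M k); the diagonal law then
  keeps only the i-th entry of N in row i.\<close>

lemma qop_absorb:
  assumes laws: "nBA_laws n A" and c: "c \<in> univ A"
    and M: "range M \<subseteq> univ A" and N: "range N \<subseteq> univ A"
  shows "qop n A c (M(i := qop n A c N)) = qop n A c (M(i := N i))"
proof -
  define P where "P k = (if k = i then N else (\<lambda>_. M k))" for k
  have P: "P k j \<in> univ A" for k j
    using M N unfolding P_def by auto
  have "M(i := qop n A c N) = (\<lambda>k. qop n A c (P k))"
    using nBA_lawsD(2)[OF laws c] M unfolding P_def by (auto simp: image_subset_iff)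
  moreover have "M(i := N i) = (\<lambda>k. P k k)"
    unfolding P_def by auto
  ultimately show ?thesis
    using nBA_lawsD(3)[OF laws c, of P] P by simp
qed

text \<open>The kernel of the i-th coordinate of q(c, -): a and b are indistinguishable at position
  i. Under the laws this is an explicit description of theta(c, e_i) for i in {1..n}, see
  \<open>princ_cong_eq_coord_rel\<close>.\<close>

definition coord_rel :: "nat \<Rightarrow> (nu_sym, 'a) algebra \<Rightarrow> 'a \<Rightarrow> nat \<Rightarrow> ('a \<times> 'a) set" where
  "coord_rel n A c i = {(a, b). a \<in> univ A \<and> b \<in> univ A \<and>
     (\<forall>M. range M \<subseteq> univ A \<longrightarrow> qop n A c (M(i := a)) = qop n A c (M(i := b)))}"

lemma coord_relD:
  assumes "(a, b) \<in> coord_rel n A c i" and "c \<in> univ A"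
  shows "qop n A c ((\<lambda>_. c)(i := a)) = qop n A c ((\<lambda>_. c)(i := b))"
proof -
  have "range (\<lambda>_. c) \<subseteq> univ A"
    using assms(2) by blast
  then show ?thesis
    using assms(1) unfolding coord_rel_def by blast
qed

text \<open>By absorption and commutation, inserting q(z_0, ..., z_n) at position i of q(c, -) gives
  a value that, for fixed M, depends on the z_j only through q(c, c, ..., z_j, ..., c). These agree
  for related arguments.\<close>

lemma congruence_coord_rel:
  assumes A: "is_algebra (nu_sig n) A" and laws: "nBA_laws n A" and c: "c \<in> univ A"
  shows "congruence (nu_sig n) A (coord_rel n A c i)"
proof -
  let ?r = "coord_rel n A c i"
  have eq: "equiv (univ A) ?r"
    by (rule equivI) (auto simp: coord_rel_def refl_on_def sym_def trans_def)
  have "(oper A f xs, oper A f ys) \<in> ?r"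
    if f: "nu_sig n f = Some (length xs)" and rel: "list_all2 (\<lambda>x y. (x, y) \<in> ?r) xs ys" for f xs ys
  proof (cases f)
    case (Esym j)
    then have "j \<in> {1..n}" "xs = []" "ys = []"
      using f rel by (auto simp: nu_sig_def split: if_splits)
    then show ?thesis
      using Esym ecst_in_univ[OF A] eq unfolding ecst_def equiv_def refl_on_def by blast
  next
    case Qsym
    then have len: "length xs = Suc n" "length ys = Suc n"
      using f rel by (auto simp: nu_sig_def list_all2_lengthD)
    have nth: "(xs ! j, ys ! j) \<in> ?r" if "j < Suc n" for j
      using rel len that by (auto simp: list_all2_conv_all_nth)
    then have xy: "xs ! j \<in> univ A" "ys ! j \<in> univ A" if "j < Suc n" for j
      using that unfolding coord_rel_def by auto
    then have ops: "oper A Qsym xs \<in> univ A" "oper A Qsym ys \<in> univ A"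
      using len by (auto intro!: oper_Qsym_in_univ[OF A] simp: in_set_conv_nth)
    have main: "qop n A c (M(i := oper A Qsym zs)) =
        qop n A c (M(i := oper A Qsym (map (\<lambda>j. qop n A c ((\<lambda>_. c)(i := zs ! j))) [0..<Suc n])))"
      if M: "range M \<subseteq> univ A" and zs: "length zs = Suc n" "\<And>j. j < Suc n \<Longrightarrow> zs ! j \<in> univ A"
      for M zs
    proof -
      \<comment> \<open>Row i holds the arguments zs; all other rows, and the columns beyond n, are
        filled with c. Hence N i is q applied to zs.\<close>
      define P where "P k j = (if k = i \<and> j < Suc n then zs ! j else c)" for k j
      define N where "N k = oper A Qsym (map (P k) [0..<Suc n])" for k
      have P: "P k j \<in> univ A" for k j
        using zs c unfolding P_def by auto
      have N: "range N \<subseteq> univ A"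
        using P unfolding N_def by (auto intro!: oper_Qsym_in_univ[OF A] simp del: upt_Suc)
      have "map (P i) [0..<Suc n] = zs"
        using zs(1) unfolding P_def by (intro nth_equalityI) (auto simp del: upt_Suc)
      \<comment> \<open>Absorption exchanges N i for q(c, N), which commutation then evaluates
        column by column.\<close>
      then have "qop n A c (M(i := oper A Qsym zs)) = qop n A c (M(i := qop n A c N))"
        using qop_absorb[OF laws c M N, of i] unfolding N_def by simp
      also have "qop n A c N = oper A Qsym (map (\<lambda>j. qop n A c (\<lambda>k. P k j)) [0..<Suc n])"
        unfolding N_def using nBA_lawsD(4)[OF laws c] P by blast
      also have "map (\<lambda>j. qop n A c (\<lambda>k. P k j)) [0..<Suc n] =
          map (\<lambda>j. qop n A c ((\<lambda>_. c)(i := zs ! j))) [0..<Suc n]"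
        unfolding P_def by (auto simp del: upt_Suc intro!: arg_cong[of _ _ "qop n A c"])
      finally show ?thesis .
    qed
    have "map (\<lambda>j. qop n A c ((\<lambda>_. c)(i := xs ! j))) [0..<Suc n] =
        map (\<lambda>j. qop n A c ((\<lambda>_. c)(i := ys ! j))) [0..<Suc n]"
      using coord_relD[OF nth c] by (simp del: upt_Suc)
    then show ?thesis
      using main[OF _ len(1) xy(1)] main[OF _ len(2) xy(2)] ops
      unfolding Qsym coord_rel_def by (simp del: upt_Suc map_eq_conv)
  qed
  then show ?thesis
    unfolding congruence_def using eq by blast
qed

text \<open>One inclusion is minimality of theta(c, e_i), since \<open>coord_rel\<close> is a
  congruence containing (c, e_i). For the other, q(c, -) with a at position i is congruent to a by
  \<open>qop_princ_cong_coordinate\<close>, likewise for b, and the two values coincide.\<close>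

lemma princ_cong_eq_coord_rel:
  assumes A: "is_algebra (nu_sig n) A" and laws: "nBA_laws n A" and c: "c \<in> univ A"
    and i: "i \<in> {1..n}"
  shows "princ_cong (nu_sig n) A c (ecst A i) = coord_rel n A c i"
proof
  have "qop n A c (M(i := c)) = qop n A c (M(i := ecst A i))" if M: "range M \<subseteq> univ A" for M
  proof -
    \<comment> \<open>The constants, padded with c to stay in the universe. Since q(c, N) = c,
      absorption replaces c by e_i.\<close>
    define N where "N k = (if k \<in> {1..n} then ecst A k else c)" for k
    have "qop n A c N = qop n A c (ecst A)"
      unfolding N_def by (rule qop_cong) simp
    then have "qop n A c N = c"
      using nBA_lawsD(5)[OF laws c] by simp
    moreover have "range N \<subseteq> univ A"
      using c ecst_in_univ[OF A] unfolding N_def by auto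
    ultimately show ?thesis
      using qop_absorb[OF laws c M, of N i] i unfolding N_def by simp
  qed
  then have "(c, ecst A i) \<in> coord_rel n A c i"
    using c ecst_in_univ[OF A i] unfolding coord_rel_def by blast
  then show "princ_cong (nu_sig n) A c (ecst A i) \<subseteq> coord_rel n A c i"
    using congruence_coord_rel[OF A laws c] unfolding princ_cong_def by blast
next
  show "coord_rel n A c i \<subseteq> princ_cong (nu_sig n) A c (ecst A i)"
  proof (rule subrelI)
    fix a b
    assume ab: "(a, b) \<in> coord_rel n A c i"
    let ?\<theta> = "princ_cong (nu_sig n) A c (ecst A i)"
    have cong: "congruence (nu_sig n) A ?\<theta>"
      using congruence_princ_cong[OF A c ecst_in_univ[OF A i]] .
    have proj: "(qop n A c M, M i) \<in> ?\<theta>" if M: "range M \<subseteq> univ A" for M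
      using qop_princ_cong_coordinate[OF A c i M nBA_lawsD(1)[OF laws M i]] .
    have "(qop n A c ((\<lambda>_. c)(i := a)), a) \<in> ?\<theta>" "(qop n A c ((\<lambda>_. c)(i := b)), b) \<in> ?\<theta>"
      using proj[of "(\<lambda>_. c)(i := a)"] proj[of "(\<lambda>_. c)(i := b)"] ab c
      unfolding coord_rel_def by auto
    moreover have "qop n A c ((\<lambda>_. c)(i := a)) = qop n A c ((\<lambda>_. c)(i := b))"
      using coord_relD[OF ab c] .
    ultimately show "(a, b) \<in> ?\<theta>"
      using cong unfolding congruence_def equiv_def by (metis symD transD)
  qed
qed

text \<open>Converse of \<open>pure_nBA_laws\<close>. With theta(c, e_i) known explicitly,
  injectivity follows from idempotence and the diagonal law, and q(c, M) solves the Chinese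
  remainder condition.\<close>

lemma laws_pure_nBA:
  fixes A :: "(nu_sym, 'a) algebra"
  assumes A: "is_algebra (nu_sig n) A" and laws: "nBA_laws n A"
  shows "is_pure_nBA n A"
  unfolding is_pure_nBA_iff
proof (intro conjI allI impI ballI)
  show "is_algebra (nu_sig n) A" by (rule A)
next
  fix b i
  assume b: "\<forall>j\<in>{1..n}. b j \<in> univ A" and i: "i \<in> {1..n}"
  \<comment> \<open>The selection law asks for a total family in the universe, so b is extended by
    its value at i.\<close>
  have eq: "qop n A (ecst A i) b = qop n A (ecst A i) (\<lambda>j. if j \<in> {1..n} then b j else b i)" (is "_ = qop n A _ ?M")
    by (rule qop_cong) simp
  have "range ?M \<subseteq> univ A"
    using b i by auto
  then show "qop n A (ecst A i) b = b i"
    unfolding eq using nBA_lawsD(1)[OF laws _ i, of ?M] i by simp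
next
  fix c
  assume c: "c \<in> univ A"
  note \<theta> = princ_cong_eq_coord_rel[OF A laws c]
  show "n_central (nu_sig n) n (\<lambda>i. Fun (Esym i) []) A c"
  proof (rule n_centralI[OF A c], unfold term_op_Esym)
    show "ecst A i \<in> univ A" if "i \<in> {1..n}" for i
      using ecst_in_univ[OF A that] .
  next
    fix x y
    assume xy: "x \<in> univ A" "y \<in> univ A"
      and rel: "\<And>i. i \<in> {1..n} \<Longrightarrow> (x, y) \<in> princ_cong (nu_sig n) A c (ecst A i)"
    \<comment> \<open>z is recovered from its coordinates q(c, c, ..., z, ..., c), with z at
      position i: the diagonal of this matrix is constantly z.\<close>
    have diag: "qop n A c (\<lambda>i. qop n A c ((\<lambda>_. c)(i := z))) = z" if "z \<in> univ A" for z
    proof -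
      have "((\<lambda>_. c)(i := z)) j \<in> univ A" for i j
        using c that by simp
      from nBA_lawsD(3)[OF laws c, of "\<lambda>i. (\<lambda>_. c)(i := z)", OF this]
      have "qop n A c (\<lambda>i. qop n A c ((\<lambda>_. c)(i := z))) = qop n A c (\<lambda>_. z)"
        by (simp only: fun_upd_same)
      then show ?thesis
        using nBA_lawsD(2)[OF laws c that] by simp
    qed
    have "qop n A c ((\<lambda>_. c)(i := x)) = qop n A c ((\<lambda>_. c)(i := y))" if "i \<in> {1..n}" for i
      using rel[OF that] unfolding \<theta>[OF that] by (rule coord_relD[OF _ c])
    then have "qop n A c (\<lambda>i. qop n A c ((\<lambda>_. c)(i := x))) = qop n A c (\<lambda>i. qop n A c ((\<lambda>_. c)(i := y)))"
      by (rule qop_cong)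
    then show "x = y"
      using diag xy by simp
  next
    fix M :: "nat \<Rightarrow> 'a"
    assume M: "range M \<subseteq> univ A"
    show "\<exists>a\<in>univ A. \<forall>i\<in>{1..n}. (a, M i) \<in> princ_cong (nu_sig n) A c (ecst A i)"
    proof (intro bexI ballI)
      show q: "qop n A c M \<in> univ A"
        using M by (intro qop_in_univ[OF A c]) auto
      \<comment> \<open>Absorption says that q(c, M) and M i are interchangeable at position
        i.\<close>
      show "(qop n A c M, M i) \<in> princ_cong (nu_sig n) A c (ecst A i)" if "i \<in> {1..n}" for i
        unfolding \<theta>[OF that] coord_rel_def
        using q M qop_absorb[OF laws c _ M] by auto
    qed
  qed
qed

lemma pure_nBA_eq_models: "{A :: (nu_sym, 'a) algebra. is_pure_nBA n A} = models (nu_sig n) (nBA_identities n)"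
proof -
  have "is_pure_nBA n A \<longleftrightarrow> is_algebra (nu_sig n) A \<and> nBA_laws n A" for A :: "(nu_sym, 'a) algebra"
    using laws_pure_nBA[of n A] pure_nBA_laws[of n A] is_pure_nBA_iff[of n A] by argo
  then show ?thesis
    unfolding models_def satisfies_nBA_identities_iff by simp
qed

text \<open>Serves both inclusions in \<open>pure_nBAs_generated\<close>:
  \<open>nBA_variety_subset\<close> applies to this class, and the class is one of the varieties
  that contain \<open>alg_n\<close>.\<close>

lemma variety_of_pure_nBAs:
  "variety_of_nBAs (nu_sig n) n (Fun Qsym (map Var [0..<Suc n])) (\<lambda>i. Fun (Esym i) [])
     {A. is_pure_nBA n A}"
proof -
  have "variety (nu_sig n) {A. is_pure_nBA n A}"
    unfolding variety_def pure_nBA_eq_models using wf_nBA_identities by blast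
  then show ?thesis
    unfolding variety_of_nBAs_def is_pure_nBA_def by blast
qed

section \<open>The algebra \<open>\<^bold>n\<close>\<close>

lemma oper_alg_n_Qsym:
  assumes "inj_on \<epsilon> {1..n}" and "k \<in> {1..n}" and "hd xs = \<epsilon> k"
  shows "oper (alg_n n \<epsilon>) Qsym xs = xs ! k"
  using the_inv_into_f_f[OF assms(1,2)] assms(3) by (simp add: alg_n_def)

lemma is_algebra_alg_n:
  assumes "inj_on \<epsilon> {1..n}" and "n \<ge> 1"
  shows "is_algebra (nu_sig n) (alg_n n \<epsilon>)"
  unfolding is_algebra_def
proof (intro conjI allI impI)
  show "univ (alg_n n \<epsilon>) \<noteq> {}"
    using assms(2) by (simp add: alg_n_def)
next
  fix f xs
  assume *: "nu_sig n f = Some (length xs) \<and> set xs \<subseteq> univ (alg_n n \<epsilon>)"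
  show "oper (alg_n n \<epsilon>) f xs \<in> univ (alg_n n \<epsilon>)"
  proof (cases f)
    case (Esym j)
    then show ?thesis
      using * by (auto simp: nu_sig_def alg_n_def split: if_splits)
  next
    case Qsym
    then have len: "length xs = Suc n"
      using * by (simp add: nu_sig_def)
    then have "hd xs \<in> univ (alg_n n \<epsilon>)"
      using * hd_in_set[of xs] by fastforce
    then obtain k where k: "k \<in> {1..n}" "hd xs = \<epsilon> k"
      by (auto simp: alg_n_def)
    then have "xs ! k \<in> set xs"
      using len by auto
    then show ?thesis
      using oper_alg_n_Qsym[OF assms(1) k] * unfolding Qsym by auto
  qed
qed

lemma qop_alg_n:
  assumes "inj_on \<epsilon> {1..n}" and "k \<in> {1..n}"
  shows "qop n (alg_n n \<epsilon>) (\<epsilon> k) M = M k"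
  unfolding qop_def using oper_alg_n_Qsym[OF assms] assms(2)
  by (cases k) (auto simp del: upt_Suc)

text \<open>Every element is some e_k, and q(e_k, -) is the k-th projection, for which the laws are
  immediate.\<close>

lemma pure_nBA_alg_n:
  assumes inj: "inj_on \<epsilon> {1..n}" and "n \<ge> 1"
  shows "is_pure_nBA n (alg_n n \<epsilon>)"
proof (rule laws_pure_nBA)
  have e: "ecst (alg_n n \<epsilon>) i = \<epsilon> i" for i
    by (simp add: ecst_def alg_n_def)
  have u: "univ (alg_n n \<epsilon>) = \<epsilon> ` {1..n}"
    by (simp add: alg_n_def)
  show "nBA_laws n (alg_n n \<epsilon>)"
    unfolding nBA_laws_def e u by (auto simp: qop_alg_n[OF inj] e simp del: upt_Suc)
qed (rule is_algebra_alg_n[OF assms])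

text \<open>When every element of B is a constant, the selection identities determine all values of
  q in B, so sending each constant to its namesake is a homomorphism.\<close>

lemma alg_epi_alg_n:
  assumes inj: "inj_on \<epsilon> {1..n}" and B: "is_pure_nBA n B" and e: "ecst B ` {1..n} = univ B"
  shows "alg_epi (nu_sig n) (alg_n n \<epsilon>) B (\<lambda>x. ecst B (the_inv_into {1..n} \<epsilon> x))"
    (is "alg_epi _ _ _ ?h")
proof -
  have h: "?h (\<epsilon> i) = ecst B i" if "i \<in> {1..n}" for i
    using the_inv_into_f_f[OF inj that] by simp
  have img: "?h ` univ (alg_n n \<epsilon>) = univ B"
    using h unfolding e[symmetric] by (simp add: alg_n_def image_image)
  have "?h (oper (alg_n n \<epsilon>) f xs) = oper B f (map ?h xs)"
    if f: "nu_sig n f = Some (length xs)" and xs: "set xs \<subseteq> univ (alg_n n \<epsilon>)" for f xs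
  proof (cases f)
    case (Esym j)
    then show ?thesis
      using f h by (auto simp: nu_sig_def alg_n_def ecst_def split: if_splits)
  next
    case Qsym
    then have len: "length xs = Suc n"
      using f by (simp add: nu_sig_def)
    then have "hd xs \<in> univ (alg_n n \<epsilon>)"
      using xs hd_in_set[of xs] by fastforce
    then obtain k where k: "k \<in> {1..n}" "hd xs = \<epsilon> k"
      by (auto simp: alg_n_def)
    \<comment> \<open>Position 0 of xs holds the selecting element e_k, so the argument with number
      j is \<open>xs ! j\<close>.\<close>
    define M where "M j = ?h (xs ! j)" for j
    have "M j \<in> univ B" if "j \<in> {1..n}" for j
      using that len xs img unfolding M_def by (metis atLeastAtMost_iff imageI le_imp_less_Suc nth_mem subsetD)
    then have "qop n B (ecst B k) M = M k"
      using B k(1) unfolding is_pure_nBA_iff by blast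
    moreover have "map ?h xs = ecst B k # map M [1..<Suc n]"
    proof (rule nth_equalityI)
      fix j
      assume "j < length (map ?h xs)"
      then show "map ?h xs ! j = (ecst B k # map M [1..<Suc n]) ! j"
        using len h[OF k(1)] k(2) hd_conv_nth[of xs] unfolding M_def
        by (cases j) (force simp del: upt_Suc)+
    qed (simp add: len)
    ultimately show ?thesis
      using oper_alg_n_Qsym[OF inj k] unfolding Qsym qop_def M_def by simp
  qed
  then show ?thesis
    unfolding alg_epi_def using img by blast
qed

lemma pure_nBAs_generated:
  fixes \<epsilon> :: "nat \<Rightarrow> 'a"
  assumes inj: "inj_on \<epsilon> {1..n}" and "n \<ge> 1"
  shows "{A. is_pure_nBA n A} = generated_variety (nu_sig n) {alg_n n \<epsilon>}"
proof
  show "{A. is_pure_nBA n A} \<subseteq> generated_variety (nu_sig n) {alg_n n \<epsilon>}"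
    unfolding generated_variety_def
  proof (rule Inter_greatest)
    fix W :: "(nu_sym, 'a) algebra set"
    assume W: "W \<in> {W. variety (nu_sig n) W \<and> {alg_n n \<epsilon>} \<subseteq> W}"
    show "{A. is_pure_nBA n A} \<subseteq> W"
    proof (rule nBA_variety_subset[OF variety_of_pure_nBAs], unfold term_op_Esym)
      show "variety (nu_sig n) W" using W by blast
    next
      fix B :: "(nu_sym, 'a) algebra"
      assume "B \<in> {A. is_pure_nBA n A}" and "bij_betw (ecst B) {1..n} (univ B)"
      then show "B \<in> W"
        using alg_epi_variety[OF _ _ alg_epi_alg_n[OF inj]] W
        unfolding bij_betw_def by blast
    qed
  qed
next
  show "generated_variety (nu_sig n) {alg_n n \<epsilon>} \<subseteq> {A. is_pure_nBA n A}"
    using variety_of_pure_nBAs[of n] pure_nBA_alg_n[OF assms]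
    unfolding generated_variety_def variety_of_nBAs_def by blast
qed

theorem theorem4p6:
  fixes n :: nat
  assumes "n \<ge> 2"
  shows "(\<forall>(\<tau> :: 'f signature) q e (V :: ('f, 'a) algebra set).
            variety_of_nBAs \<tau> n q e V \<longrightarrow>
            V = generated_variety \<tau> {A \<in> V. card (univ A) = n})
       \<and> (\<forall>\<epsilon> :: nat \<Rightarrow> 'a. inj_on \<epsilon> {1..n} \<longrightarrow>
            {A. is_pure_nBA n A} = generated_variety (nu_sig n) {alg_n n \<epsilon>})"
proof (intro conjI allI impI)
  fix \<tau> :: "'f signature" and q e and V :: "('f, 'a) algebra set"
  assume "variety_of_nBAs \<tau> n q e V"
  then show "V = generated_variety \<tau> {A \<in> V. card (univ A) = n}"
    by (rule nBA_variety_generated)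
next
  fix \<epsilon> :: "nat \<Rightarrow> 'a"
  assume "inj_on \<epsilon> {1..n}"
  then show "{A. is_pure_nBA n A} = generated_variety (nu_sig n) {alg_n n \<epsilon>}"
    using assms by (intro pure_nBAs_generated) auto
qed

end
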